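(* Let $f:\mathbf{Z} \rightarrow \mathbf{N}_0 \cup \{\infty\}$ be any function such that \[ \Delta = \operatorname{card}(f^{-1}(0)) < \infty . \] Let \[ c = 8 + \left[\frac{\Delta + 1}{2} \right]. \] There exist uncountably many sets $A$ of integers such that \[ r_{A,2}(n) = f(n) \qquad\text{for all } n \in \mathbf{Z} \] and \[ A(-x,x) \geq \left(\frac{x}{c}\right)^{1/3}. \]
   Context: $\mathbf{Z}$ denotes the integers and $\mathbf{N}_0$ the nonnegative integers. $[x]$ denotes the integer part of the real number $x$. $f^{-1}(0) = \{n \in \mathbf{Z} : f(n) = 0\}$, and $\operatorname{card}$ denotes cardinality. For a set $A \subseteq \mathbf{Z}$, the representation function $r_{A,2}: \mathbf{Z} \rightarrow \mathbf{N}_0\cup\{\infty\}$ is defined by letting $r_{A,2}(n)$ be the number of ways to write $n = a_1 + a_2$ with $a_1, a_2 \in A$ and $a_1 \leq a_2$ (that is, the number of such pairs $(a_1,a_2)$, with value $\infty$ if there are infinitely many). The counting function is $A(y,x) = \sum_{a \in A,\ y \leq a \leq x} 1$, so $A(-x,x)$ is the number of elements $a \in A$ with $|a| \leq x$.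
   Formalization: The bound A(-x,x) ≥ (x/c)^{1/3} is proved for all sufficiently large real x (threshold may depend on A); for all x > 0 it fails, e.g. for small x when f(0)=0, and for some f it also fails just above x = c. *)

theory Defs
  imports Complex_Main "HOL-Library.Extended_Nat" "HOL-Library.Countable_Set"
begin

definition representations2 :: "int set \<Rightarrow> int \<Rightarrow> (int \<times> int) set" where
  "representations2 A n = {(a, b). a \<in> A \<and> b \<in> A \<and> a \<le> b \<and> a + b = n}"

definition rep2 :: "int set \<Rightarrow> int \<Rightarrow> enat" where
  "rep2 A n = (if finite (representations2 A n)
               then enat (card (representations2 A n)) else \<infinity>)"

(* Only finitely many integers lie between two reals, so card is the true cardinality here. *)
definition counting :: "int set \<Rightarrow> real \<Rightarrow> real \<Rightarrow> nat" where
  "counting A y x = card {a \<in> A. y \<le> real_of_int a \<and> real_of_int a \<le> x}"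

end

theory Submission
  imports Defs "HOL-Library.Nat_Bijection"
begin

text \<open>
  The set is built greedily as an increasing union of finite sets \<open>A\<^sub>k\<close> with \<open>2 k\<close> elements. In step
  \<open>k\<close> one picks a \<open>u\<close> that still has fewer than \<open>f u\<close> representations and adds a pair
  \<open>b, u - b\<close>, where \<open>b\<close> is chosen such that all new sums other than \<open>u\<close> are pairwise distinct,
  are not sums of \<open>A\<^sub>k\<close>, and are not zeros of \<open>f\<close>. This excludes at most \<open>16 k\<^sup>3 + O(k\<^sup>2)\<close> values of \<open>b\<close>,
  so \<open>b\<close> can be taken of that size. As there are always at least two admissible values
  of \<open>b\<close>, the set can be made to differ from each member of a given sequence of sets: a value that is
  not used is put into a finite set \<open>F\<^sub>k\<close> of integers that are excluded forever.
\<close>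

section \<open>Sumsets and representation counts of finite sets\<close>

definition sums2 :: "int set \<Rightarrow> int set" where
  "sums2 A = (\<lambda>(x, y). x + y) ` (A \<times> A)"

lemma sums2I: "x \<in> A \<Longrightarrow> y \<in> A \<Longrightarrow> x + y \<in> sums2 A"
  unfolding sums2_def by force

lemma finite_sums2: "finite A \<Longrightarrow> finite (sums2 A)"
  unfolding sums2_def by simp

lemma card_image_times_le:
  assumes "finite A" "finite B"
  shows "card (h ` (A \<times> B)) \<le> card A * card B"
  using card_image_le[of "A \<times> B" h] assms by (simp add: card_cartesian_product)

lemma card_sums2_le: "finite A \<Longrightarrow> card (sums2 A) \<le> card A * card A"
  unfolding sums2_def by (rule card_image_times_le)

lemma finite_representations2:
  assumes "finite A"
  shows "finite (representations2 A n)"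
  by (rule finite_subset[of _ "A \<times> A"]) (use assms in \<open>auto simp: representations2_def\<close>)

lemma rep2_finite: "finite A \<Longrightarrow> rep2 A n = enat (card (representations2 A n))"
  by (simp add: rep2_def finite_representations2)

lemma representations2_mono: "A \<subseteq> B \<Longrightarrow> representations2 A n \<subseteq> representations2 B n"
  by (auto simp: representations2_def)

lemma representations2_eq_empty: "n \<notin> sums2 A \<Longrightarrow> representations2 A n = {}"
  using sums2I by (auto simp: representations2_def)


section \<open>Adding one pair\<close>

text \<open>\<open>T\<close> is the set of values that the new sums, apart from \<open>b + (u - b)\<close>, have to avoid.\<close>

definition bad_choices :: "int set \<Rightarrow> int set \<Rightarrow> int set \<Rightarrow> int \<Rightarrow> int set" where
  "bad_choices T A F u =
     (A \<union> F) \<union> (\<lambda>x. u - x) ` (A \<union> F) \<union>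
     (\<lambda>(x, t). t - x) ` (A \<times> T) \<union> (\<lambda>(x, t). x + u - t) ` (A \<times> T) \<union>
     (\<lambda>t. t div 2) ` T \<union> (\<lambda>t. u - t div 2) ` T \<union>
     (\<lambda>(x, y). (y - x + u) div 2) ` (A \<times> A) \<union>
     (\<lambda>x. (2 * u - x) div 3) ` A \<union> (\<lambda>x. (x + u) div 3) ` A"

lemma finite_bad_choices:
  "finite T \<Longrightarrow> finite A \<Longrightarrow> finite F \<Longrightarrow> finite (bad_choices T A F u)"
  by (simp add: bad_choices_def)

lemma card_bad_choices_le:
  assumes "finite T" "finite A" "finite F"
  shows "card (bad_choices T A F u) \<le>
    2 * (card A + card F) + 2 * (card A * card T) + 2 * card T + card A * card A + 2 * card A"
proof -
  have le: "card (X \<union> Y) \<le> a + b" if "card X \<le> a" "card Y \<le> b" for X Y :: "int set" and a b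
    using card_Un_le[of X Y] that by linarith
  have AF: "card (A \<union> F) \<le> card A + card F" by (rule card_Un_le)
  have AF': "card ((\<lambda>x. u - x) ` (A \<union> F)) \<le> card A + card F"
    using card_image_le[of "A \<union> F" "\<lambda>x. u - x"] AF assms by force
  have "card (bad_choices T A F u) \<le>
    (card A + card F) + (card A + card F) + card A * card T + card A * card T + card T + card T +
    card A * card A + card A + card A"
    unfolding bad_choices_def
    by (intro le AF AF' card_image_times_le card_image_le assms)
  then show ?thesis by (simp add: algebra_simps)
qed

text \<open>Each piece of \<open>bad_choices\<close> is an unwanted coincidence solved for
  \<open>b\<close>. Rounding in \<open>div\<close> is harmless, because the coincidence makes the
  division exact.\<close>

lemma not_bad_choicesD:
  assumes "b \<notin> bad_choices T A F u"
  shows "b \<notin> A" "b \<notin> F" "u - b \<notin> A" "u - b \<notin> F"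
    "\<And>x. x \<in> A \<Longrightarrow> b + x \<notin> T"
    "\<And>x. x \<in> A \<Longrightarrow> (u - b) + x \<notin> T"
    "2 * b \<notin> T" "2 * (u - b) \<notin> T"
    "\<And>x y. x \<in> A \<Longrightarrow> y \<in> A \<Longrightarrow> b + x \<noteq> (u - b) + y"
    "\<And>x. x \<in> A \<Longrightarrow> b + x \<noteq> 2 * (u - b)"
    "\<And>x. x \<in> A \<Longrightarrow> (u - b) + x \<noteq> 2 * b"
proof -
  have nb: "b \<notin> A \<union> F" "b \<notin> (\<lambda>x. u - x) ` (A \<union> F)" "b \<notin> (\<lambda>(x, t). t - x) ` (A \<times> T)"
     "b \<notin> (\<lambda>(x, t). x + u - t) ` (A \<times> T)"
     "b \<notin> (\<lambda>t. t div 2) ` T" "b \<notin> (\<lambda>t. u - t div 2) ` T"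
     "b \<notin> (\<lambda>(x, y). (y - x + u) div 2) ` (A \<times> A)"
     "b \<notin> (\<lambda>x. (2 * u - x) div 3) ` A" "b \<notin> (\<lambda>x. (x + u) div 3) ` A"
    using assms unfolding bad_choices_def by blast+
  show "b \<notin> A" "b \<notin> F" using nb(1) by auto
  have "u - b \<notin> A \<union> F"
  proof
    assume "u - b \<in> A \<union> F"
    then have "u - (u - b) \<in> (\<lambda>x. u - x) ` (A \<union> F)" by (rule imageI)
    with nb(2) show False by simp
  qed
  then show "u - b \<notin> A" "u - b \<notin> F" by auto
  show "b + x \<notin> T" if "x \<in> A" for x
    using nb(3) that by (force simp: image_iff)
  show "(u - b) + x \<notin> T" if "x \<in> A" for x
    using nb(4) that by (force simp: image_iff)
  show "2 * b \<notin> T" using nb(5) by (force simp: image_iff)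
  show "2 * (u - b) \<notin> T" using nb(6) by (force simp: image_iff)
  show "b + x \<noteq> (u - b) + y" if "x \<in> A" "y \<in> A" for x y
  proof
    assume "b + x = (u - b) + y"
    then have "b = (y - x + u) div 2" by presburger
    with nb(7) that show False by (force simp: image_iff)
  qed
  show "b + x \<noteq> 2 * (u - b)" if "x \<in> A" for x
  proof
    assume "b + x = 2 * (u - b)"
    then have "b = (2 * u - x) div 3" by presburger
    with nb(8) that show False by blast
  qed
  show "(u - b) + x \<noteq> 2 * b" if "x \<in> A" for x
  proof
    assume "(u - b) + x = 2 * b"
    then have "b = (x + u) div 3" by presburger
    with nb(9) that show False by blast
  qed
qed

text \<open>The sum \<open>b + (u - b)\<close> gives \<open>u\<close> exactly one more
  representation. Every other new sum avoids the old sums and the zeros of \<open>f\<close>, so it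
  had no representation before, gets a single one, and \<open>f\<close> is at least 1 there.\<close>

lemma add_pair:
  fixes f :: "int \<Rightarrow> enat"
  assumes A: "finite A" and le: "\<And>n. rep2 A n \<le> f n" and less: "rep2 A u < f u"
    and b: "b \<notin> bad_choices (sums2 A \<union> {n. f n = 0} \<union> {u}) A F u"
  defines "B \<equiv> A \<union> {b, u - b}"
  shows "card B = card A + 2"
    and "card (representations2 B u) = Suc (card (representations2 A u))"
    and "rep2 B n \<le> f n"
proof -
  define T where "T = sums2 A \<union> {n. f n = 0} \<union> {u}"
  note nb = not_bad_choicesD[OF b, folded T_def]
  define c where "c = u - b"
  have u: "u = b + c" by (simp add: c_def)
  note nb = nb[folded c_def]
  have B: "B = A \<union> {b, c}" by (simp add: B_def c_def)
  \<comment> \<open>With \<open>u\<close> in \<open>T\<close>, the only new sum equal to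
    \<open>u\<close> is \<open>b + c\<close>. It also forces \<open>b \<noteq> c\<close>, since
    otherwise \<open>2 * b = u\<close> would lie in \<open>T\<close>.\<close>
  have "u \<in> T" by (simp add: T_def)
  have bc: "b \<noteq> c" using nb(7) \<open>u \<in> T\<close> u by auto
  show "card B = card A + 2" using A nb bc unfolding B by simp
  have finB: "finite B" using A B by simp
  have new: "n = u \<and> (p = b \<and> q = c \<or> p = c \<and> q = b) \<or> p \<in> A \<and> q \<in> A \<or> n \<notin> T"
    if "p \<in> B" "q \<in> B" "p + q = n" for p q n
    using that nb(5)[of p] nb(5)[of q] nb(6)[of p] nb(6)[of q] nb(7,8)
    unfolding B u by (auto simp: algebra_simps)
  have repu: "representations2 B u = insert (min b c, max b c) (representations2 A u)"
  proof
    show "representations2 B u \<subseteq> insert (min b c, max b c) (representations2 A u)"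
      using new[of _ _ u] \<open>u \<in> T\<close> by (fastforce simp: representations2_def min_def max_def)
    show "insert (min b c, max b c) (representations2 A u) \<subseteq> representations2 B u"
      unfolding representations2_def B u by (auto simp: min_def max_def)
  qed
  have "(min b c, max b c) \<notin> representations2 A u"
    using nb(1,3) by (auto simp: representations2_def min_def max_def)
  then show card_u: "card (representations2 B u) = Suc (card (representations2 A u))"
    unfolding repu using finite_representations2[OF A] by simp
  show "rep2 B n \<le> f n"
  proof (cases "n = u")
    case True
    then show ?thesis
      using less card_u unfolding rep2_finite[OF finB] rep2_finite[OF A]
      by (metis eSuc_enat ileI1)
  next
    case False
    show ?thesis
    proof (cases "n \<in> T")
      case True
      have "representations2 B n \<subseteq> representations2 A n"
        using new[of _ _ n] \<open>n \<noteq> u\<close> True by (fastforce simp: representations2_def)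
      moreover have "representations2 A n \<subseteq> representations2 B n"
        by (rule representations2_mono) (auto simp: B)
      ultimately have "representations2 B n = representations2 A n" by blast
      then show ?thesis using le[of n] unfolding rep2_finite[OF finB] rep2_finite[OF A] by simp
    next
      case n: False
      have inj: "p = p' \<and> q = q'"
        if "p \<in> B" "q \<in> B" "p \<le> q" "p' \<in> B" "q' \<in> B" "p' \<le> q'" "p + q = n" "p' + q' = n" for p q p' q'
      proof -
        \<comment> \<open>As \<open>n\<close> is neither an old sum nor \<open>u\<close>, a pair
          with sum \<open>n\<close> has one of four shapes. Different shapes have different sums,
          and within one shape \<open>n\<close> determines \<open>x\<close>, so the pair is
          unique.\<close>
        have cases: "(\<exists>x\<in>A. (p = min b x \<and> q = max b x) \<and> n = b + x) \<or>
            (\<exists>x\<in>A. (p = min c x \<and> q = max c x) \<and> n = c + x) \<or>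
            (p = b \<and> q = b \<and> n = 2 * b) \<or> (p = c \<and> q = c \<and> n = 2 * c)"
          if "p \<in> B" "q \<in> B" "p \<le> q" "p + q = n" for p q
        proof -
          have "\<not> (p \<in> A \<and> q \<in> A)" using n sums2I[of p A q] that by (auto simp: T_def)
          moreover have "p + q \<noteq> b + c" using False u that by simp
          ultimately have "(\<exists>x\<in>A. (p = b \<and> q = x \<or> p = x \<and> q = b) \<and> n = b + x) \<or>
            (\<exists>x\<in>A. (p = c \<and> q = x \<or> p = x \<and> q = c) \<and> n = c + x) \<or>
            (p = b \<and> q = b \<and> n = 2 * b) \<or> (p = c \<and> q = c \<and> n = 2 * c)"
            using that unfolding B by (elim UnE insertE) (auto simp: add.commute)
          then show ?thesis
            using \<open>p \<le> q\<close> by (elim disjE bexE conjE) (auto simp: min_def max_def)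
        qed
        have nb': "b + x \<noteq> 2 * b" "c + x \<noteq> 2 * c" if "x \<in> A" for x
          using nb(1,3) that by auto
        show ?thesis
          using cases[OF that(1-3,7)] cases[OF that(4-6,8)] nb(9,10,11) nb' bc
          by (elim disjE bexE conjE) (simp_all, metis+)
      qed
      have "card (representations2 B n) \<le> 1"
        unfolding One_nat_def card_le_Suc0_iff_eq[OF finite_representations2[OF finB]]
        using inj by (auto simp: representations2_def)
      moreover have "f n \<ge> 1" using n by (auto simp: T_def ileI1 one_eSuc iless_Suc_eq)
      ultimately show ?thesis unfolding rep2_finite[OF finB] one_enat_def
        by (meson enat_ord_simps(1) order_trans)
    qed
  qed
qed


section \<open>The construction\<close>

text \<open>The leading term is \<open>2 * (2 * k) * (4 * k ^ 2)\<close>, from the two families of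
  differences between \<open>A\<close> and \<open>T\<close> in \<open>bad_choices\<close>. All
  lower-order terms are absorbed by the passage from \<open>k\<close> to
  \<open>Suc k\<close>.\<close>

definition stage_bound :: "nat \<Rightarrow> nat \<Rightarrow> nat" where
  "stage_bound d k = 16 * k ^ 3 + 4 * d * k ^ 2"

text \<open>The invariant of the construction. The exact size of \<open>A\<close> serves both the
  count of excluded values and the final growth estimate; \<open>F\<close> gains at most one element
  per step.\<close>

definition stage :: "(int \<Rightarrow> enat) \<Rightarrow> nat \<Rightarrow> int set \<Rightarrow> int set \<Rightarrow> bool" where
  "stage f k A F \<longleftrightarrow> finite A \<and> finite F \<and> card A = 2 * k \<and> card F \<le> k \<and> A \<inter> F = {} \<and>
     (\<forall>n. rep2 A n \<le> f n) \<and>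
     (\<forall>a\<in>A. \<bar>a\<bar> \<le> int (stage_bound (card {n. f n = 0}) k))"

text \<open>The integer \<open>e\<close> is preferred. If it is saturated, pigeonhole gives a small
  \<open>u\<close> that is neither a sum of \<open>A\<close> nor a zero of \<open>f\<close>, so
  every step can add a pair.\<close>

lemma exists_next_target:
  assumes A: "finite A" and fin: "finite {n. f n = 0}" and e: "\<bar>e\<bar> \<le> int k"
  obtains u where "rep2 A u < f u" "rep2 A e < f e \<Longrightarrow> u = e"
    "\<bar>u\<bar> \<le> int (card A * card A + card {n. f n = 0} + k)"
proof (cases "rep2 A e < f e")
  case True
  show ?thesis by (rule that[of e]) (use True e order_trans[OF e] in auto)
next
  case False
  let ?d = "card {n. f n = 0}" and ?X = "sums2 A \<union> {n. f n = 0}"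
  let ?I = "{0..int (card A * card A + ?d)}"
  have "card ?X \<le> card A * card A + ?d"
    using card_Un_le[of "sums2 A" "{n. f n = 0}"] card_sums2_le[OF A] by linarith
  then have "card ?X < card ?I" by (simp add: nat_add_distrib nat_mult_distrib)
  moreover have "finite ?X" using A fin finite_sums2 by simp
  ultimately have "\<not> ?I \<subseteq> ?X" using card_mono[of ?X ?I] by linarith
  then obtain u where u: "u \<in> ?I" "u \<notin> ?X" by blast
  then have "rep2 A u < f u"
    by (simp add: rep2_finite[OF A] representations2_eq_empty zero_enat_def[symmetric])
  with u False show ?thesis by (intro that[of u]) auto
qed

text \<open>The last conjunct separates the final set from \<open>S\<close>. Of two admissible
  choices \<open>b\<close>, \<open>b'\<close>, the pair of \<open>b'\<close> is added if
  \<open>b'\<close> lies outside \<open>S\<close>; otherwise the pair of \<open>b\<close> is added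
  and \<open>b'\<close> is banned through \<open>F'\<close>.\<close>

lemma exists_next_stage:
  assumes st: "stage f k A F" and fin: "finite {n. f n = 0}" and e: "\<bar>e\<bar> \<le> int k"
  shows "\<exists>A' F'. stage f (Suc k) A' F' \<and> A \<subseteq> A' \<and> F \<subseteq> F' \<and>
    (rep2 A e < f e \<longrightarrow> card (representations2 A' e) = Suc (card (representations2 A e))) \<and>
    (A' - S) \<union> (F' \<inter> S) \<noteq> {}"
proof -
  define d where "d = card {n. f n = 0}"
  have A: "finite A" and F: "finite F" and cA: "card A = 2 * k" and cF: "card F \<le> k"
    and disj: "A \<inter> F = {}" and rep: "\<And>n. rep2 A n \<le> f n"
    and bnd: "\<And>a. a \<in> A \<Longrightarrow> \<bar>a\<bar> \<le> int (stage_bound d k)"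
    using st unfolding stage_def d_def by auto
  obtain u where less: "rep2 A u < f u" and ue: "rep2 A e < f e \<Longrightarrow> u = e"
    and u_le: "\<bar>u\<bar> \<le> int (card A * card A + d + k)"
    using exists_next_target[OF A fin e] unfolding d_def by blast
  define T where "T = sums2 A \<union> {n. f n = 0} \<union> {u}"
  have finT: "finite T" using A fin finite_sums2 by (simp add: T_def)
  have cT: "card T \<le> 4 * k ^ 2 + d + 1"
  proof -
    have "card T \<le> card (sums2 A) + card {n. f n = 0} + card {u}"
      unfolding T_def by (intro order_trans[OF card_Un_le] add_mono card_Un_le order_refl)
    then show ?thesis
      using card_sums2_le[OF A] by (simp add: cA d_def power2_eq_square)
  qed
  \<comment> \<open>The bound for the number of bad values, plus 2 to leave room for also avoiding
    \<open>b\<close> and \<open>u - b\<close>.\<close>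
  define M where "M = 16 * k ^ 3 + 12 * k ^ 2 + (14 + 4 * d) * k + 2 * d + 4"
  let ?bad = "bad_choices T A F u"
  have "card ?bad \<le> 2 * (2 * k + k) + 2 * (2 * k * (4 * k ^ 2 + d + 1)) + 2 * (4 * k ^ 2 + d + 1)
      + 2 * k * (2 * k) + 2 * (2 * k)"
    by (rule order_trans[OF card_bad_choices_le[OF finT A F]], unfold cA)
      (intro add_mono mult_mono cT cF order_refl; simp)
  also have "\<dots> + 2 = M"
    by (simp add: M_def algebra_simps power2_eq_square power3_eq_cube)
  finally have bad_le: "card ?bad + 2 \<le> M" by simp
  have finbad: "finite ?bad" using finT A F by (rule finite_bad_choices)
  have pick: "\<exists>b\<in>{0..int M}. b \<notin> ?bad \<and> b \<notin> X" if "finite X" "card X \<le> 2" for X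
  proof -
    have "card (?bad \<union> X) < card {0..int M}"
      using card_Un_le[of ?bad X] bad_le that by simp
    then have "\<not> {0..int M} \<subseteq> ?bad \<union> X"
      using card_mono[of "?bad \<union> X" "{0..int M}"] finbad that by (meson finite_UnI not_le)
    then show ?thesis by blast
  qed
  obtain b where b: "b \<in> {0..int M}" "b \<notin> ?bad" using pick[of "{}"] by auto
  \<comment> \<open>Avoiding \<open>u - b\<close> as well as \<open>b\<close> keeps
    \<open>b'\<close> out of the pair of \<open>b\<close>, so that \<open>b'\<close> may be put into
    \<open>F'\<close>.\<close>
  obtain b' where b': "b' \<in> {0..int M}" "b' \<notin> ?bad" "b' \<notin> {b, u - b}"
    using pick[of "{b, u - b}"] card_insert_le_m1[of 2 "{u - b}" b] by auto
  \<comment> \<open>Both \<open>x\<close> and \<open>u - x\<close> are at most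
    \<open>M + \<bar>u\<bar>\<close> in absolute value.\<close>
  have M_le: "M + (card A * card A + d + k) \<le> stage_bound d (Suc k)"
    by (simp add: M_def cA stage_bound_def algebra_simps power2_eq_square power3_eq_cube)
  have mono: "stage_bound d k \<le> stage_bound d (Suc k)"
    unfolding stage_bound_def by (intro add_mono mult_mono power_mono) auto
  have step: "stage f (Suc k) (A \<union> {x, u - x}) F'"
    if x: "x \<in> {0..int M}" "x \<notin> ?bad"
      and F': "finite F'" "card F' \<le> Suc k" "F' \<inter> (A \<union> {x, u - x}) = {}" for x F'
  proof -
    note add = add_pair[OF A rep less x(2)[unfolded T_def]]
    have "\<bar>u\<bar> + int M \<le> int (stage_bound d (Suc k))" using u_le M_le by linarith
    then have "\<bar>a\<bar> \<le> int (stage_bound d (Suc k))" if "a \<in> A \<union> {x, u - x}" for a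
      using that bnd[of a] mono x(1) by auto
    then show ?thesis
      unfolding stage_def using A F' add(1,3) cA by (auto simp flip: d_def)
  qed
  have card_e: "rep2 A e < f e \<longrightarrow> card (representations2 (A \<union> {x, u - x}) e) =
      Suc (card (representations2 A e))" if "x \<notin> ?bad" for x
    using add_pair(2)[OF A rep less that[unfolded T_def]] ue by auto
  show ?thesis
  proof (cases "b' \<in> S")
    case True
    have "stage f (Suc k) (A \<union> {b, u - b}) (insert b' F)"
      using F cF disj b b' not_bad_choicesD(1-4)[OF b(2)] not_bad_choicesD(1)[OF b'(2)]
      by (intro step) (auto simp: card_insert_if)
    with True card_e[OF b(2)] show ?thesis
      by (intro exI[of _ "A \<union> {b, u - b}"] exI[of _ "insert b' F"]) auto
  next
    case False
    have "stage f (Suc k) (A \<union> {b', u - b'}) F"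
      using F cF disj b' not_bad_choicesD(1-4)[OF b'(2)] by (intro step) auto
    with False card_e[OF b'(2)] show ?thesis
      by (intro exI[of _ "A \<union> {b', u - b'}"] exI[of _ F]) auto
  qed
qed

section \<open>Scheduling of the targets and the limit set\<close>

text \<open>Projecting the pairing function to one component makes each integer come up infinitely
  often, so that \<open>n\<close> is served until it has \<open>f n\<close> representations.\<close>

definition recurrent_int :: "nat \<Rightarrow> int" where
  "recurrent_int k = int_decode (fst (prod_decode k))"

text \<open>Keeps the scheduled target within the cubic size bound of the stages.\<close>

lemma abs_recurrent_int_le: "\<bar>recurrent_int k\<bar> \<le> int k"
proof -
  have "\<bar>int_decode m\<bar> \<le> int m" for m
    unfolding int_decode_def sum_decode_def by (auto; presburger)
  moreover have "fst (prod_decode k) \<le> k"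
    using le_prod_encode_1[of "fst (prod_decode k)" "snd (prod_decode k)"] by simp
  ultimately show ?thesis unfolding recurrent_int_def by (meson of_nat_mono order_trans)
qed

lemma recurrent_int_recurs: "\<exists>k\<ge>j. recurrent_int k = n"
  by (rule exI[of _ "prod_encode (int_encode n, j)"])
    (simp add: recurrent_int_def le_prod_encode_2)

text \<open>Finitely many representations over the union already live in one stage, so a finite
  \<open>f n\<close> is not exceeded. Recurring visits to \<open>n\<close> push the count up to any
  finite value not above \<open>f n\<close>.\<close>

lemma rep2_Union_stages:
  assumes inc: "\<And>k. A k \<subseteq> A (Suc k)" and fin: "\<And>k. finite (A k)"
    and le: "\<And>k. rep2 (A k) n \<le> f n"
    and step: "\<And>k. recurrent_int k = n \<Longrightarrow> rep2 (A k) n < f n \<Longrightarrow>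
      card (representations2 (A (Suc k)) n) = Suc (card (representations2 (A k) n))"
  shows "rep2 (\<Union>k. A k) n = f n"
proof -
  let ?R = "\<lambda>k. representations2 (A k) n" and ?L = "representations2 (\<Union>k. A k) n"
  have mono: "A i \<subseteq> A j" if "i \<le> j" for i j using inc that by (rule lift_Suc_mono_le)
  have finR: "finite (?R k)" for k using fin by (rule finite_representations2)
  have sub: "?R k \<subseteq> ?L" for k by (rule representations2_mono) blast
  have upper: "\<exists>k. X \<subseteq> ?R k" if "finite X" "X \<subseteq> ?L" for X
    using that
  proof (induction X rule: finite_induct)
    case (insert p X)
    then obtain k i j where k: "X \<subseteq> ?R k" and "fst p \<in> A i" "snd p \<in> A j"
      by (auto simp: representations2_def)
    then have "fst p \<in> A (i + j + k)" "snd p \<in> A (i + j + k)"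
      using mono[of i "i + j + k"] mono[of j "i + j + k"] by auto
    then have "p \<in> ?R (i + j + k)"
      using insert.prems by (auto simp: representations2_def)
    moreover have "?R k \<subseteq> ?R (i + j + k)" by (intro representations2_mono mono) simp
    ultimately show ?case using k by blast
  qed auto
  have lower: "\<exists>k. card (?R k) \<ge> j" if "enat j \<le> f n" for j
    using that
  proof (induction j)
    case (Suc j)
    then have j: "enat j < f n" by (simp add: Suc_ile_eq)
    then obtain k where k: "card (?R k) \<ge> j" using Suc.IH by (metis less_imp_le)
    \<comment> \<open>At the next visit to \<open>n\<close> the count either already exceeds
      \<open>j\<close> or is raised from \<open>j\<close> to \<open>Suc j\<close>.\<close>
    obtain l where l: "l \<ge> k" "recurrent_int l = n" using recurrent_int_recurs by blast
    have kl: "j \<le> card (?R l)"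
      using k card_mono[OF finR representations2_mono[OF mono[OF l(1)]]] by linarith
    show ?case
    proof (cases "card (?R l) = j")
      case True
      then show ?thesis using step[OF l(2)] j rep2_finite[OF fin] by (intro exI[of _ "Suc l"]) simp
    next
      case False
      with kl show ?thesis by (intro exI[of _ l]) simp
    qed
  qed simp
  show ?thesis
  proof (cases "f n")
    case (enat m)
    have "card (?R k) \<le> m" for k using le[of k] rep2_finite[OF fin] enat by simp
    then have "card X \<le> m" if "finite X" "X \<subseteq> ?L" for X
      using upper[OF that] card_mono[OF finR] by (meson order_trans)
    then have L: "finite ?L" "card ?L \<le> m"
      using finite_if_finite_subsets_card_bdd[of ?L] by auto
    obtain k where "card (?R k) \<ge> m" using lower[of m] enat by auto
    with L have "card ?L = m" using card_mono[OF L(1) sub[of k]] by simp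
    with L enat show ?thesis by (simp add: rep2_def)
  next
    case infinity
    have "infinite ?L"
    proof
      assume L: "finite ?L"
      obtain k where "card (?R k) \<ge> Suc (card ?L)" using lower infinity by auto
      with card_mono[OF L sub[of k]] show False by simp
    qed
    with infinity show ?thesis by (simp add: rep2_def)
  qed
qed

section \<open>Growth of the counting function\<close>

lemma counting_ge:
  assumes "B \<subseteq> A" and "\<And>a. a \<in> B \<Longrightarrow> \<bar>real_of_int a\<bar> \<le> x"
  shows "card B \<le> counting A (- x) x"
proof -
  have "{a \<in> A. - x \<le> real_of_int a \<and> real_of_int a \<le> x} \<subseteq> {\<lceil>- x\<rceil>..\<lfloor>x\<rfloor>}"
    by (auto simp: ceiling_le_iff le_floor_iff)
  then have "finite {a \<in> A. - x \<le> real_of_int a \<and> real_of_int a \<le> x}"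
    by (rule finite_subset) simp
  then show ?thesis
    unfolding counting_def by (rule card_mono) (use assms in \<open>fastforce simp: abs_le_iff\<close>)
qed

text \<open>
  The elements of \<open>A\<^sub>k\<close> are of size about \<open>16 k\<^sup>3\<close>, so up to lower order terms
  \<open>A(-x, x) \<ge> 2 (x / 16)\<^sup>1\<^sup>/\<^sup>3 > (x / 8)\<^sup>1\<^sup>/\<^sup>3\<close>.
\<close>

lemma eventually_counting_ge:
  assumes sub: "\<And>k. A k \<subseteq> B" and card: "\<And>k. card (A k) = 2 * k"
    and bound: "\<And>k a. a \<in> A k \<Longrightarrow> \<bar>a\<bar> \<le> int (stage_bound d k)"
    and c: "c \<ge> 8"
  shows "\<forall>\<^sub>F x :: real in at_top. real (counting B (- x) x) \<ge> root 3 (x / c)"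
proof -
  show ?thesis
    \<comment> \<open>The threshold gives \<open>y \<ge> 16 + d\<close> for the cube root
      \<open>y\<close> of \<open>x\<close>, hence \<open>d \<le> y\<close> and
      \<open>1 \<le> y / 16\<close>.\<close>
    using eventually_ge_at_top[of "(16 + real d) ^ 3"]
  proof eventually_elim
    case (elim x)
    define y where "y = root 3 x"
    have y: "y \<ge> 16 + real d"
      using real_root_le_mono[of 3, OF _ elim] by (simp add: y_def real_root_power_cancel)
    have x: "x = y ^ 3" by (simp add: y_def odd_real_root_pow)
    \<comment> \<open>The least \<open>k\<close> for which the \<open>2 * k\<close> elements of
      \<open>A k\<close> number at least \<open>y / 2\<close>, the cube root of
      \<open>x / 8\<close>.\<close>
    define k where "k = nat \<lceil>y / 4\<rceil>"
    have k: "y / 4 \<le> real k" "real k \<le> y / 4 + 1" using y unfolding k_def by linarith+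
    have "real (stage_bound d k) = 16 * real k ^ 3 + 4 * real d * real k ^ 2"
      by (simp add: stage_bound_def)
    \<comment> \<open>Here \<open>k \<le> y / 4 + 1 \<le> 5 / 16 * y\<close>. The right-hand side
      equals \<open>225 / 256 * y ^ 3\<close>.\<close>
    also have "\<dots> \<le> 16 * (5 / 16 * y) ^ 3 + 4 * y * (5 / 16 * y) ^ 2"
      using k y by (intro add_mono mult_mono power_mono) auto
    also have "\<dots> \<le> x"
      using y by (simp add: x power2_eq_square power3_eq_cube)
    finally have "real (stage_bound d k) \<le> x" .
    moreover have "\<bar>real_of_int a\<bar> \<le> real (stage_bound d k)" if "a \<in> A k" for a
      using bound[OF that] by linarith
    ultimately have "card (A k) \<le> counting B (- x) x"
      by (intro counting_ge sub) (meson order_trans)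
    then have "2 * real k \<le> real (counting B (- x) x)" unfolding card by linarith
    moreover have "root 3 (x / c) \<le> y / 2"
    proof -
      have "x / c \<le> x / 8" using c x y by (intro divide_left_mono) auto
      also have "\<dots> = (y / 2) ^ 3" by (simp add: x power_divide)
      finally have "root 3 (x / c) \<le> root 3 ((y / 2) ^ 3)" by simp
      also have "\<dots> = y / 2" using y by (simp add: real_root_power_cancel)
      finally show ?thesis .
    qed
    ultimately show ?case using k by linarith
  qed
qed

section \<open>Diagonalisation and uncountability\<close>

text \<open>Dependent choice iterates the step, with step \<open>k\<close> devoted to
  \<open>S k\<close>: the next stage contains a point outside \<open>S k\<close> or permanently bans
  a point of \<open>S k\<close>.\<close>

lemma exists_set_avoiding_sequence:
  fixes f :: "int \<Rightarrow> enat" and S :: "nat \<Rightarrow> int set" and c :: real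
  assumes fin: "finite {n. f n = 0}" and c: "c \<ge> 8"
  obtains A where "\<And>n. rep2 A n = f n"
    "\<forall>\<^sub>F x :: real in at_top. real (counting A (- x) x) \<ge> root 3 (x / c)"
    "\<And>k. A \<noteq> S k"
proof -
  let ?P = "\<lambda>k X. stage f k (fst X) (snd X)"
  let ?Q = "\<lambda>k X X'. fst X \<subseteq> fst X' \<and> snd X \<subseteq> snd X' \<and>
    (rep2 (fst X) (recurrent_int k) < f (recurrent_int k) \<longrightarrow>
      card (representations2 (fst X') (recurrent_int k)) =
      Suc (card (representations2 (fst X) (recurrent_int k)))) \<and>
    (fst X' - S k) \<union> (snd X' \<inter> S k) \<noteq> {}"
  have "?P 0 ({}, {})"
    by (simp add: stage_def rep2_finite representations2_def zero_enat_def[symmetric])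
  then have "\<exists>X. ?P 0 X" by blast
  moreover have "\<exists>X'. ?P (Suc k) X' \<and> ?Q k X X'" if "?P k X" for k X
    using exists_next_stage[OF that fin abs_recurrent_int_le, where S = "S k"] by simp
  ultimately obtain X where X: "\<And>k. ?P k (X k)" "\<And>k. ?Q k (X k) (X (Suc k))"
    using dependent_nat_choice[of ?P ?Q] by blast
  define A F where "A k = fst (X k)" and "F k = snd (X k)" for k
  note st = X(1)[folded A_def F_def] and Q = X(2)[folded A_def F_def]
  have monoA: "A i \<subseteq> A j" if "i \<le> j" for i j
    by (rule lift_Suc_mono_le[OF _ that]) (use Q in auto)
  have monoF: "F i \<subseteq> F j" if "i \<le> j" for i j
    by (rule lift_Suc_mono_le[OF _ that]) (use Q in auto)
  \<comment> \<open>Both sets are contained in those of the common stage \<open>max i j\<close>,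
    which are disjoint. Hence banned points never enter the union.\<close>
  have disj: "A i \<inter> F j = {}" for i j
    using st[of "max i j"] monoA[of i "max i j"] monoF[of j "max i j"]
    by (auto simp: stage_def)
  show ?thesis
  proof (rule that[of "\<Union>k. A k"])
    show "rep2 (\<Union>k. A k) n = f n" for n
      using st Q by (intro rep2_Union_stages) (auto simp: stage_def)
    show "\<forall>\<^sub>F x :: real in at_top. real (counting (\<Union>k. A k) (- x) x) \<ge> root 3 (x / c)"
      using st c by (intro eventually_counting_ge[of A]) (auto simp: stage_def)
    show "(\<Union>k. A k) \<noteq> S k" for k
      using Q[of k] disj[of _ "Suc k"] by blast
  qed
qed

theorem theorem1:
  fixes f :: "int \<Rightarrow> enat" and \<Delta> :: nat and c :: int
  assumes "finite {n. f n = 0}"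
    and "\<Delta> = card {n. f n = 0}"
    and "c = 8 + \<lfloor>(real \<Delta> + 1) / 2\<rfloor>"
  shows "uncountable {A :: int set.
           (\<forall>n. rep2 A n = f n) \<and>
           (\<forall>\<^sub>F x :: real in at_top. real (counting A (- x) x) \<ge> root 3 (x / real_of_int c))}"
    (is "uncountable ?S")
proof
  have c: "real_of_int c \<ge> 8" using assms(3) by simp
  assume "countable ?S"
  \<comment> \<open>A countable \<open>?S\<close> is covered by the range of
    \<open>from_nat_into ?S\<close>, yet \<open>A\<close> belongs to \<open>?S\<close> and avoids
    that range.\<close>
  obtain A where "\<And>n. rep2 A n = f n"
    "\<forall>\<^sub>F x :: real in at_top. real (counting A (- x) x) \<ge> root 3 (x / real_of_int c)"
    "\<And>k. A \<noteq> from_nat_into ?S k"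
    using exists_set_avoiding_sequence[OF assms(1) c, of "from_nat_into ?S"] by blast
  then have "A \<in> ?S" and "A \<notin> range (from_nat_into ?S)" by auto
  with \<open>countable ?S\<close> show False using subset_range_from_nat_into by blast
qed

end
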